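(* Let $A$ be a finite-dimensional algebra over a linearly ordered field $\mathbb{F}$. For every maximal partial order $\le$ on $A$, the rank of $\le$, i.e. the sum of the dimensions of all central factors in an adapted series of convex ideals for $\le$, does not depend on the choice of the adapted series. Moreover, all maximal partial orders on $A$ have equal ranks.
   Context: An algebra is a vector space with a bilinear multiplication, not assumed associative, Lie, commutative or unital. A partially ordered algebra over a linearly ordered field $\mathbb{F}$ is an algebra $A$ with a partial order making $A$ a partially ordered vector space (compatible with addition and with multiplication by nonnegative scalars) such that $a>0$ implies $ab<a$ and $ba<a$ for all $b\in A$. "Partial order on $A$" always means one of this kind. It is maximal if no other such partial order on $A$ properly refines (extends) it. An ideal $I$ is convex if $0\le b\le a\in I$ implies $b\in I$; then $A/I$ has the induced partial order: $x+I\le y+I$ iff $a\le b$ for some $a\in x+I$, $b\in y+I$. An order is trivial if no two distinct elements are comparable. Let $0=I_0<I_1<\dots<I_s=A$ be a series of ideals. The factor $I_{j}/I_{j-1}$ is central if it annihilates $A/I_{j-1}$ (all products of its elements with elements of $A/I_{j-1}$, on either side, are zero), and chief if it is a minimal nonzero ideal of $A/I_{j-1}$. The partial order is lexicographic with respect to a series of convex ideals if for all $x\ne y$ and the maximal $k$ with $x+I_k\ne y+I_k$, $x$ and $y$ are related (less, greater or incomparable) exactly as $x+I_k$ and $y+I_k$ are in $A/I_k$. An adapted series for a maximal partial order $\le$ is a finite series of convex ideals such that each factor is either central with linear induced order, or a noncentral chief factor with trivial induced order, and such that $\le$ is lexicographic with respect to it. (Every maximal partial order on a finite-dimensional algebra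 over a linearly ordered field has an adapted series.) *)

theory Defs
  imports Complex_Main
begin

section \<open>Algebras over a linearly ordered field\<close>

text \<open>
  The multiplication is only assumed to be bilinear: it need not be associative, commutative,
  unital or Lie.
\<close>

locale nonassoc_algebra = vector_space scale
  for scale :: "'f::linordered_field \<Rightarrow> 'a::ab_group_add \<Rightarrow> 'a" +
  fixes mult :: "'a \<Rightarrow> 'a \<Rightarrow> 'a"
  assumes linear_mult_left: "Vector_Spaces.linear scale scale (\<lambda>x. mult x y)"
    and linear_mult_right: "Vector_Spaces.linear scale scale (\<lambda>y. mult x y)"
begin

definition finite_dimensional :: bool where
  "finite_dimensional \<longleftrightarrow> (\<exists>B. finite B \<and> span B = UNIV)"

definition ideal :: "'a set \<Rightarrow> bool" where
  "ideal I \<longleftrightarrow> subspace I \<and> (\<forall>x\<in>I. \<forall>a. mult x a \<in> I \<and> mult a x \<in> I)"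


section \<open>Quotient algebras\<close>

text \<open>
  The elements of the quotient by \<open>I\<close> are the cosets of \<open>I\<close>; its zero is \<open>I\<close> itself.
  The operations are defined on sets without choosing representatives; for an ideal \<open>I\<close> they
  are the usual ones, see the three lemmas after the definitions.  A summand from \<open>I\<close>
  is added in \<open>qscale\<close> and \<open>qmult\<close> because the elementwise products of cosets need
  not fill a whole coset.
\<close>

definition coset :: "'a set \<Rightarrow> 'a \<Rightarrow> 'a set" where
  "coset I x = {x + i |i. i \<in> I}"

definition quot :: "'a set \<Rightarrow> 'a set set" where
  "quot I = range (coset I)"

definition qadd :: "'a set \<Rightarrow> 'a set \<Rightarrow> 'a set" where
  "qadd X Y = {x + y |x y. x \<in> X \<and> y \<in> Y}"

definition qscale :: "'a set \<Rightarrow> 'f \<Rightarrow> 'a set \<Rightarrow> 'a set" where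
  "qscale I c X = {scale c x + i |x i. x \<in> X \<and> i \<in> I}"

definition qmult :: "'a set \<Rightarrow> 'a set \<Rightarrow> 'a set \<Rightarrow> 'a set" where
  "qmult I X Y = {mult x y + i |x y i. x \<in> X \<and> y \<in> Y \<and> i \<in> I}"

lemma qadd_coset:
  assumes "ideal I"
  shows "qadd (coset I x) (coset I y) = coset I (x + y)"
proof
  have I: "subspace I" using assms by (simp add: ideal_def)
  show "qadd (coset I x) (coset I y) \<subseteq> coset I (x + y)"
  proof
    fix z assume "z \<in> qadd (coset I x) (coset I y)"
    then obtain i j where "i \<in> I" "j \<in> I" "z = (x + i) + (y + j)"
      by (auto simp: qadd_def coset_def)
    then have "z = (x + y) + (i + j)" "i + j \<in> I"
      by (auto simp: algebra_simps subspace_add[OF I])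
    then show "z \<in> coset I (x + y)" by (auto simp: coset_def)
  qed
  show "coset I (x + y) \<subseteq> qadd (coset I x) (coset I y)"
  proof
    fix z assume "z \<in> coset I (x + y)"
    then obtain i where "i \<in> I" "z = (x + 0) + (y + i)"
      by (auto simp: coset_def algebra_simps)
    then show "z \<in> qadd (coset I x) (coset I y)"
      using subspace_0[OF I] unfolding qadd_def coset_def by blast
  qed
qed

lemma qscale_coset:
  assumes "ideal I"
  shows "qscale I c (coset I x) = coset I (scale c x)"
proof
  have I: "subspace I" using assms by (simp add: ideal_def)
  show "qscale I c (coset I x) \<subseteq> coset I (scale c x)"
  proof
    fix z assume "z \<in> qscale I c (coset I x)"
    then obtain i j where "i \<in> I" "j \<in> I" "z = scale c (x + i) + j"
      by (auto simp: qscale_def coset_def)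
    then have "z = scale c x + (scale c i + j)" "scale c i + j \<in> I"
      by (auto simp: algebra_simps subspace_add[OF I] subspace_scale[OF I])
    then show "z \<in> coset I (scale c x)" by (auto simp: coset_def)
  qed
  show "coset I (scale c x) \<subseteq> qscale I c (coset I x)"
  proof
    fix z assume "z \<in> coset I (scale c x)"
    then obtain i where "i \<in> I" "z = scale c (x + 0) + i"
      by (auto simp: coset_def)
    then show "z \<in> qscale I c (coset I x)"
      using subspace_0[OF I] unfolding qscale_def coset_def by blast
  qed
qed

lemma qmult_coset:
  assumes "ideal I"
  shows "qmult I (coset I x) (coset I y) = coset I (mult x y)"
proof
  have I: "subspace I" using assms by (simp add: ideal_def)
  have add_l: "mult (u + v) w = mult u w + mult v w" for u v w
  proof -
    interpret l: Vector_Spaces.linear scale scale "\<lambda>x. mult x w" by (rule linear_mult_left)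
    show ?thesis by (rule l.add)
  qed
  have add_r: "mult w (u + v) = mult w u + mult w v" for u v w
  proof -
    interpret l: Vector_Spaces.linear scale scale "\<lambda>y. mult w y" by (rule linear_mult_right)
    show ?thesis by (rule l.add)
  qed
  show "qmult I (coset I x) (coset I y) \<subseteq> coset I (mult x y)"
  proof
    fix z assume "z \<in> qmult I (coset I x) (coset I y)"
    then obtain i j k where ijk: "i \<in> I" "j \<in> I" "k \<in> I"
      and z: "z = mult (x + i) (y + j) + k"
      unfolding qmult_def coset_def by blast
    have "z = mult x y + (mult x j + (mult i (y + j) + k))"
      by (simp add: z add_l add_r algebra_simps)
    moreover have "mult x j + (mult i (y + j) + k) \<in> I"
      using assms ijk by (auto simp: ideal_def intro!: subspace_add[OF I])
    ultimately show "z \<in> coset I (mult x y)" by (auto simp: coset_def)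
  qed
  show "coset I (mult x y) \<subseteq> qmult I (coset I x) (coset I y)"
  proof
    fix z assume "z \<in> coset I (mult x y)"
    then obtain i where "i \<in> I" "z = mult (x + 0) (y + 0) + i"
      by (auto simp: coset_def)
    then show "z \<in> qmult I (coset I x) (coset I y)"
      using subspace_0[OF I] unfolding qmult_def coset_def by blast
  qed
qed

definition quot_ideal :: "'a set \<Rightarrow> 'a set set \<Rightarrow> bool" where
  "quot_ideal I K \<longleftrightarrow> K \<subseteq> quot I \<and> I \<in> K
     \<and> (\<forall>X\<in>K. \<forall>Y\<in>K. qadd X Y \<in> K)
     \<and> (\<forall>c. \<forall>X\<in>K. qscale I c X \<in> K)
     \<and> (\<forall>X\<in>K. \<forall>Y\<in>quot I. qmult I X Y \<in> K \<and> qmult I Y X \<in> K)"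

text \<open>\<open>factor I J\<close> is the subset \<open>J/I\<close> of the quotient by \<open>I\<close>, when \<open>I \<subseteq> J\<close>.\<close>

definition factor :: "'a set \<Rightarrow> 'a set \<Rightarrow> 'a set set" where
  "factor I J = coset I ` J"

definition central_factor :: "'a set \<Rightarrow> 'a set \<Rightarrow> bool" where
  "central_factor I J \<longleftrightarrow>
     (\<forall>X\<in>factor I J. \<forall>Y\<in>quot I. qmult I X Y = I \<and> qmult I Y X = I)"

definition chief_factor :: "'a set \<Rightarrow> 'a set \<Rightarrow> bool" where
  "chief_factor I J \<longleftrightarrow> quot_ideal I (factor I J) \<and> factor I J \<noteq> {I}
     \<and> (\<forall>K. quot_ideal I K \<and> K \<subseteq> factor I J \<longrightarrow> K = {I} \<or> K = factor I J)"

text \<open>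
  A basis of \<open>J/I\<close> is given by a set \<open>B\<close> of representatives of the basis elements.  The linear
  combination of the cosets of the \<open>b \<in> B\<close> with coefficients \<open>u b\<close> is the coset of
  \<open>\<Sum>b\<in>B. scale (u b) b\<close>.  Independence forces distinct elements of \<open>B\<close> to have distinct cosets,
  so \<open>card B\<close> is the number of basis elements.
\<close>

definition factor_basis :: "'a set \<Rightarrow> 'a set \<Rightarrow> 'a set \<Rightarrow> bool" where
  "factor_basis I J B \<longleftrightarrow> finite B \<and> B \<subseteq> J
     \<and> (\<forall>u. coset I (\<Sum>b\<in>B. scale (u b) b) = I \<longrightarrow> (\<forall>b\<in>B. u b = 0))
     \<and> (\<forall>X\<in>factor I J. \<exists>u. X = coset I (\<Sum>b\<in>B. scale (u b) b))"

definition factor_dim :: "'a set \<Rightarrow> 'a set \<Rightarrow> nat" where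
  "factor_dim I J = card (SOME B. factor_basis I J B)"


section \<open>Partial orders on an algebra\<close>

text \<open>An order is represented by the relation \<open>r = {(x, y). x \<le> y}\<close>.\<close>

definition algebra_order :: "('a \<times> 'a) set \<Rightarrow> bool" where
  "algebra_order r \<longleftrightarrow> partial_order_on UNIV r
     \<and> (\<forall>x y z. (x, y) \<in> r \<longrightarrow> (x + z, y + z) \<in> r)
     \<and> (\<forall>c x y. 0 \<le> c \<and> (x, y) \<in> r \<longrightarrow> (scale c x, scale c y) \<in> r)
     \<and> (\<forall>a b. (0, a) \<in> r \<and> a \<noteq> 0 \<longrightarrow>
          ((mult a b, a) \<in> r \<and> mult a b \<noteq> a) \<and> ((mult b a, a) \<in> r \<and> mult b a \<noteq> a))"

definition maximal_order :: "('a \<times> 'a) set \<Rightarrow> bool" where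
  "maximal_order r \<longleftrightarrow> algebra_order r \<and> (\<nexists>r'. algebra_order r' \<and> r \<subset> r')"

definition convex_ideal :: "('a \<times> 'a) set \<Rightarrow> 'a set \<Rightarrow> bool" where
  "convex_ideal r I \<longleftrightarrow> ideal I \<and> (\<forall>a\<in>I. \<forall>b. (0, b) \<in> r \<and> (b, a) \<in> r \<longrightarrow> b \<in> I)"

definition quot_order :: "('a \<times> 'a) set \<Rightarrow> 'a set \<Rightarrow> ('a set \<times> 'a set) set" where
  "quot_order r I =
     {(X, Y). X \<in> quot I \<and> Y \<in> quot I \<and> (\<exists>a\<in>X. \<exists>b\<in>Y. (a, b) \<in> r)}"

definition linear_factor :: "('a \<times> 'a) set \<Rightarrow> 'a set \<Rightarrow> 'a set \<Rightarrow> bool" where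
  "linear_factor r I J \<longleftrightarrow> linear_order_on (factor I J) (Restr (quot_order r I) (factor I J))"

definition trivial_factor :: "('a \<times> 'a) set \<Rightarrow> 'a set \<Rightarrow> 'a set \<Rightarrow> bool" where
  "trivial_factor r I J \<longleftrightarrow>
     (\<forall>X\<in>factor I J. \<forall>Y\<in>factor I J. X \<noteq> Y \<longrightarrow> (X, Y) \<notin> quot_order r I)"


section \<open>Adapted series and rank\<close>

text \<open>A series \<open>0 = I\<^sub>0 < \<dots> < I\<^sub>s = A\<close> is given by \<open>s\<close> and a function \<open>I\<close>,
  of which only the values at \<open>0, \<dots>, s\<close> matter.\<close>

definition convex_series :: "('a \<times> 'a) set \<Rightarrow> nat \<Rightarrow> (nat \<Rightarrow> 'a set) \<Rightarrow> bool" where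
  "convex_series r s I \<longleftrightarrow> I 0 = {0} \<and> I s = UNIV
     \<and> (\<forall>j<s. I j \<subset> I (Suc j)) \<and> (\<forall>j\<le>s. convex_ideal r (I j))"

text \<open>In the following definition \<open>k\<close> is the maximal index at which the cosets of \<open>x\<close> and \<open>y\<close>
  differ.  Exchanging \<open>x\<close> and \<open>y\<close> gives the corresponding equivalence for \<open>(y, x)\<close>,
  so that all cases (less, greater, incomparable) are covered.\<close>

definition lexicographic :: "('a \<times> 'a) set \<Rightarrow> nat \<Rightarrow> (nat \<Rightarrow> 'a set) \<Rightarrow> bool" where
  "lexicographic r s I \<longleftrightarrow>
     (\<forall>x y k. x \<noteq> y \<and> k \<le> s \<and> coset (I k) x \<noteq> coset (I k) y
         \<and> (\<forall>j. k < j \<and> j \<le> s \<longrightarrow> coset (I j) x = coset (I j) y) \<longrightarrow>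
       ((x, y) \<in> r \<longleftrightarrow> (coset (I k) x, coset (I k) y) \<in> quot_order r (I k)))"

definition adapted_series :: "('a \<times> 'a) set \<Rightarrow> nat \<Rightarrow> (nat \<Rightarrow> 'a set) \<Rightarrow> bool" where
  "adapted_series r s I \<longleftrightarrow> convex_series r s I
     \<and> (\<forall>j<s. (central_factor (I j) (I (Suc j)) \<and> linear_factor r (I j) (I (Suc j)))
            \<or> (\<not> central_factor (I j) (I (Suc j)) \<and> chief_factor (I j) (I (Suc j))
                 \<and> trivial_factor r (I j) (I (Suc j))))
     \<and> lexicographic r s I"

definition series_rank :: "nat \<Rightarrow> (nat \<Rightarrow> 'a set) \<Rightarrow> nat" where
  "series_rank s I =
     (\<Sum>j | j < s \<and> central_factor (I j) (I (Suc j)). factor_dim (I j) (I (Suc j)))"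

text \<open>The rank is introduced as a relation, since that it does not depend on the adapted series
  is a theorem.\<close>

definition has_rank :: "('a \<times> 'a) set \<Rightarrow> nat \<Rightarrow> bool" where
  "has_rank r n \<longleftrightarrow> (\<exists>s I. adapted_series r s I \<and> series_rank s I = n)"

end

end

theory Submission
  imports Defs
begin

text \<open>
  Central factors and noncentral chief factors behave like the composition factors of the
  Jordan--Hoelder theorem, so we count dimensions in the Zassenhaus refinement.  For two series
  \<open>I\<close> and \<open>J\<close>, let \<open>d(j, k)\<close> be the dimension of
  \<open>(I\<^sub>j\<^sub>+\<^sub>1 \<inter> J\<^sub>k\<^sub>+\<^sub>1) / ((I\<^sub>j \<inter> J\<^sub>k\<^sub>+\<^sub>1) + (I\<^sub>j\<^sub>+\<^sub>1 \<inter> J\<^sub>k))\<close>.  It is an alternating sum of dimensions of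
  intersections, so summing it over \<open>k\<close> telescopes to \<open>dim (I\<^sub>j\<^sub>+\<^sub>1 / I\<^sub>j)\<close>, and likewise for
  \<open>j\<close>.  It vanishes if one of the factors \<open>I\<^sub>j\<^sub>+\<^sub>1 / I\<^sub>j\<close>, \<open>J\<^sub>k\<^sub>+\<^sub>1 / J\<^sub>k\<close> is central and the
  other is a noncentral chief factor.  Hence both ranks equal the sum of \<open>d(j, k)\<close> over all pairs
  of central factors.
\<close>

context nonassoc_algebra
begin

section \<open>Ideals and cosets; central and chief factors in terms of elements\<close>

lemma mult_add_left: "mult (x + y) z = mult x z + mult y z"
  using linear_mult_left[of z] by (simp add: Vector_Spaces.linear_def module_hom_def module_hom_axioms_def)

lemma mult_add_right: "mult z (x + y) = mult z x + mult z y"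
  using linear_mult_right[of z] by (simp add: Vector_Spaces.linear_def module_hom_def module_hom_axioms_def)

lemma ideal_Int: "ideal I \<Longrightarrow> ideal J \<Longrightarrow> ideal (I \<inter> J)"
  by (auto simp: ideal_def subspace_inter)

lemma ideal_sum:
  assumes "ideal I" "ideal J"
  shows "ideal {x + y |x y. x \<in> I \<and> y \<in> J}"
proof -
  have "subspace {x + y |x y. x \<in> I \<and> y \<in> J}"
    using assms by (simp add: ideal_def subspace_sums)
  then show ?thesis
    using assms by (fastforce simp: ideal_def mult_add_left mult_add_right)
qed

lemma coset_eq_iff:
  assumes "subspace I"
  shows "coset I x = coset I y \<longleftrightarrow> x - y \<in> I"
proof
  assume "coset I x = coset I y"
  moreover have "x \<in> coset I x"
    using subspace_0[OF assms] by (force simp: coset_def)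
  ultimately show "x - y \<in> I" by (auto simp: coset_def)
next
  have sub: "coset I x \<subseteq> coset I y" if "x - y \<in> I" for x y
  proof
    fix z assume "z \<in> coset I x"
    then obtain i where i: "i \<in> I" "z = x + i" by (auto simp: coset_def)
    then have "z = y + ((x - y) + i)" "(x - y) + i \<in> I"
      using that by (auto simp: subspace_add[OF assms])
    then show "z \<in> coset I y" unfolding coset_def by blast
  qed
  assume "x - y \<in> I"
  moreover from this have "y - x \<in> I"
    using subspace_neg[OF assms] by fastforce
  ultimately show "coset I x = coset I y" by (intro equalityI sub)
qed

lemma coset_zero: "coset I 0 = I"
  by (simp add: coset_def)

lemma coset_eq_ideal_iff: "subspace I \<Longrightarrow> coset I x = I \<longleftrightarrow> x \<in> I"
  using coset_eq_iff[of I x 0] by (simp add: coset_zero)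

lemma coset_in_factor_iff:
  assumes "subspace I" "subspace J" "I \<subseteq> J"
  shows "coset I x \<in> factor I J \<longleftrightarrow> x \<in> J"
proof
  assume "coset I x \<in> factor I J"
  then obtain y where "y \<in> J" "x - y \<in> I"
    by (auto simp: factor_def coset_eq_iff[OF assms(1)])
  then show "x \<in> J"
    using assms subspace_add[OF assms(2), of "x - y" y] by auto
qed (simp add: factor_def)

lemma quot_ideal_factor:
  assumes "ideal I" "ideal K"
  shows "quot_ideal I (factor I K)"
proof -
  have K: "subspace K" using assms by (simp add: ideal_def)
  have "I \<in> factor I K"
    unfolding factor_def using coset_zero[of I] subspace_0[OF K] by (metis imageI)
  moreover have "mult x y \<in> K \<and> mult y x \<in> K" if "x \<in> K" for x y
    using assms(2) that by (auto simp: ideal_def)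
  ultimately show ?thesis
    unfolding quot_ideal_def
    by (auto simp: factor_def quot_def qadd_coset[OF assms(1)] qscale_coset[OF assms(1)]
        qmult_coset[OF assms(1)] subspace_add[OF K] subspace_scale[OF K])
qed

lemma central_factor_iff:
  assumes "ideal I"
  shows "central_factor I J \<longleftrightarrow> (\<forall>x\<in>J. \<forall>y. mult x y \<in> I \<and> mult y x \<in> I)"
proof -
  have "subspace I" using assms by (simp add: ideal_def)
  then show ?thesis
    by (auto simp: central_factor_def factor_def quot_def qmult_coset[OF assms] coset_eq_ideal_iff)
qed

text \<open>Ideals between \<open>I\<close> and \<open>J\<close> yield ideals of the quotient inside
  \<open>factor I J\<close>, and distinct ones stay distinct there, so minimality leaves only the
  two ends. This moves chief factors from cosets to ideals of the algebra itself.\<close>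

lemma chief_factorD:
  assumes "chief_factor I J" "ideal I" "ideal J" "ideal K" "I \<subseteq> K" "K \<subseteq> J"
  shows "K = I \<or> K = J"
proof -
  have I: "subspace I" and K: "subspace K" and J: "subspace J"
    using assms by (simp_all add: ideal_def)
  have "factor I K \<subseteq> factor I J" using assms(6) by (auto simp: factor_def)
  then have "factor I K = {I} \<or> factor I K = factor I J"
    using assms(1) quot_ideal_factor[OF assms(2,4)] by (auto simp: chief_factor_def)
  then show ?thesis
  proof
    assume "factor I K = {I}"
    then have "coset I x = I" if "x \<in> K" for x using that by (auto simp: factor_def)
    then show ?thesis using assms(5) by (auto simp: coset_eq_ideal_iff[OF I])
  next
    assume "factor I K = factor I J"
    then have "x \<in> K \<longleftrightarrow> x \<in> J" for x
      using coset_in_factor_iff[OF I K assms(5), of x] coset_in_factor_iff[OF I J, of x] assms(5,6)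
      by auto
    then show ?thesis by auto
  qed
qed

end

locale fin_dim_nonassoc_algebra =
  nonassoc_algebra scale mult + finite_dimensional_vector_space scale Basis
  for scale :: "'f::linordered_field \<Rightarrow> 'a::ab_group_add \<Rightarrow> 'a" and mult Basis
begin

section \<open>Dimensions of factors\<close>

text \<open>The representatives span a complement of \<open>I\<close> in \<open>J\<close>, so the
  dimension formula for sums of subspaces applies. In particular all bases of the factor have the
  same size.\<close>

lemma factor_basis_card:
  assumes "factor_basis I J B" "subspace I" "subspace J" "I \<subseteq> J"
  shows "card B + dim I = dim J"
proof -
  have B: "finite B" "B \<subseteq> J"
    and ind: "\<And>u. (\<Sum>b\<in>B. scale (u b) b) \<in> I \<Longrightarrow> \<forall>b\<in>B. u b = 0"
    and sp: "\<And>x. x \<in> J \<Longrightarrow> \<exists>u. x - (\<Sum>b\<in>B. scale (u b) b) \<in> I"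
    using assms(1)
    by (auto simp: factor_basis_def factor_def coset_eq_ideal_iff[OF assms(2)] coset_eq_iff[OF assms(2)])
  have "independent B"
    using ind subspace_0[OF assms(2)] unfolding dependent_finite[OF B(1)] by fastforce
  moreover have "span B \<inter> I = {0}"
  proof -
    have "x = 0" if "x \<in> span B" "x \<in> I" for x
      using that by (auto simp: span_finite[OF B(1)] dest!: ind)
    then show ?thesis using subspace_0[OF assms(2)] span_zero[of B] by blast
  qed
  moreover have "{x + y |x y. x \<in> span B \<and> y \<in> I} = J"
  proof
    show "{x + y |x y. x \<in> span B \<and> y \<in> I} \<subseteq> J"
      using span_minimal[OF B(2) assms(3)] assms(4) by (auto intro!: subspace_add[OF assms(3)])
    show "J \<subseteq> {x + y |x y. x \<in> span B \<and> y \<in> I}"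
    proof
      fix x assume "x \<in> J"
      then obtain u where "x - (\<Sum>b\<in>B. scale (u b) b) \<in> I" using sp by blast
      moreover have "(\<Sum>b\<in>B. scale (u b) b) \<in> span B" by (simp add: span_finite[OF B(1)])
      moreover have "x = (\<Sum>b\<in>B. scale (u b) b) + (x - (\<Sum>b\<in>B. scale (u b) b))" by simp
      ultimately show "x \<in> {x + y |x y. x \<in> span B \<and> y \<in> I}" by blast
    qed
  qed
  ultimately show ?thesis
    using dim_sums_Int[OF subspace_span[of B] assms(2)] by (simp add: dim_eq_card_independent)
qed

text \<open>A basis \<open>C\<close> of \<open>I\<close> is extended to a basis \<open>D\<close> of
  \<open>J\<close>; the added vectors represent a basis of the factor.\<close>

lemma factor_basis_exists:
  assumes "subspace I" "subspace J" "I \<subseteq> J"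
  obtains B where "factor_basis I J B"
proof -
  obtain C where C: "C \<subseteq> I" "independent C" "I \<subseteq> span C" by (rule basis_exists)
  have spC: "span C = I" using span_subspace[OF C(1,3) assms(1)] .
  obtain D where D: "C \<subseteq> D" "D \<subseteq> J" "independent D" "J \<subseteq> span D"
    using maximal_independent_subset_extend[of C J] C assms(3) by blast
  have fin: "finite D" using D(3) by (rule finiteI_independent)
  then have finC: "finite C" and finB: "finite (D - C)" using D(1) finite_subset by auto
  have DC: "D = (D - C) \<union> C" using D(1) by blast
  have "factor_basis I J (D - C)"
    unfolding factor_basis_def factor_def ball_simps coset_eq_ideal_iff[OF assms(1)]
      coset_eq_iff[OF assms(1)]
  proof (intro conjI allI impI ballI)
    fix u b assume "(\<Sum>b\<in>D - C. scale (u b) b) \<in> I" and b: "b \<in> D - C"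
    then obtain v where v: "(\<Sum>b\<in>D - C. scale (u b) b) = (\<Sum>b\<in>C. scale (v b) b)"
      using spC by (auto simp: span_finite[OF finC])
    \<comment> \<open>The relation is moved to one side: \<open>w\<close> gives the coefficients of
      a vanishing combination of the whole basis \<open>D\<close>.\<close>
    define w where "w b = (if b \<in> C then - v b else u b)" for b
    have "(\<Sum>b\<in>D. scale (w b) b) = (\<Sum>b\<in>D - C. scale (w b) b) + (\<Sum>b\<in>C. scale (w b) b)"
      using D(1) fin by (rule sum.subset_diff)
    also have "\<dots> = (\<Sum>b\<in>D - C. scale (u b) b) + (\<Sum>b\<in>C. - scale (v b) b)"
      by (simp add: w_def)
    also have "\<dots> = 0" by (simp add: v sum_negf)
    finally have "w b = 0" using independentD[OF D(3) fin] b by auto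
    then show "u b = 0" using b by (simp add: w_def)
  next
    fix x assume "x \<in> J"
    then have "x \<in> span ((D - C) \<union> C)" using D(4) DC by auto
    then obtain y z where "x = y + z" "y \<in> span (D - C)" "z \<in> I"
      unfolding span_Un spC by blast
    then obtain u where "x = (\<Sum>b\<in>D - C. scale (u b) b) + z"
      by (auto simp: span_finite[OF finB])
    with \<open>z \<in> I\<close> show "\<exists>u. x - (\<Sum>b\<in>D - C. scale (u b) b) \<in> I"
      by (intro exI[of _ u]) simp
  qed (use finB D(2) in auto)
  then show thesis by (rule that)
qed

text \<open>The choice made by \<open>SOME\<close> is harmless, since a basis exists and each has
  this size. The additive form avoids truncated subtraction.\<close>

lemma factor_dim_add:
  assumes "subspace I" "subspace J" "I \<subseteq> J"
  shows "factor_dim I J + dim I = dim J"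
  unfolding factor_dim_def
  using factor_basis_exists[OF assms] factor_basis_card[OF _ assms] by (metis someI)

section \<open>Central against noncentral chief factors\<close>

text \<open>The equation says that the Zassenhaus factor of the two given factors is zero. The ideal
  \<open>S K\<close>, the sum of \<open>J\<close> and \<open>K \<inter> J'\<close>, lies between
  \<open>J\<close> and \<open>J'\<close>, so it is one of them. If \<open>S I = J'\<close>, the
  modular law splits \<open>I' \<inter> J'\<close>; otherwise centrality of \<open>I'\<close> over
  \<open>I\<close> forces \<open>S I' = J\<close> too, and both sides coincide.\<close>

lemma dim_Int_central_chief:
  assumes id: "ideal I" "ideal I'" "ideal J" "ideal J'"
    and sub: "I \<subseteq> I'" "J \<subseteq> J'"
    and central: "central_factor I I'"
    and chief: "\<not> central_factor J J'" "chief_factor J J'"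
  shows "dim (I' \<inter> J') + dim (I \<inter> J) = dim (I \<inter> J') + dim (I' \<inter> J)"
proof -
  have ss: "subspace I" "subspace I'" "subspace J" "subspace J'"
    using id by (simp_all add: ideal_def)
  define S where "S K = {x + y |x y. x \<in> J \<and> y \<in> K \<inter> J'}" for K
  have S: "S K = J \<or> S K = J'" if "ideal K" for K
  proof (rule chief_factorD[OF chief(2) id(3,4)])
    show "ideal (S K)" unfolding S_def using that id by (intro ideal_sum ideal_Int)
    have "x + 0 \<in> S K" if "x \<in> J" for x
      using that subspace_0[of K] subspace_0[OF ss(4)] \<open>ideal K\<close>
      unfolding S_def ideal_def by blast
    then show "J \<subseteq> S K" by auto
    show "S K \<subseteq> J'" using sub(2) by (auto simp: S_def intro!: subspace_add[OF ss(4)])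
  qed
  have Int_sub: "K \<inter> J' \<subseteq> J" if "S K = J" for K
  proof
    fix x assume "x \<in> K \<inter> J'"
    then have "0 + x \<in> S K" unfolding S_def using subspace_0[OF ss(3)] by blast
    then show "x \<in> J" using that by simp
  qed
  show ?thesis
  proof (cases "S I = J'")
    case True
    \<comment> \<open>Modular law: decompose \<open>x\<close> in \<open>S I\<close>; the summand
      from \<open>J\<close> is a difference of elements of \<open>I'\<close>.\<close>
    have "I' \<inter> J' = {x + y |x y. x \<in> I' \<inter> J \<and> y \<in> I \<inter> J'}"
    proof
      show "I' \<inter> J' \<subseteq> {x + y |x y. x \<in> I' \<inter> J \<and> y \<in> I \<inter> J'}"
      proof
        fix x assume x: "x \<in> I' \<inter> J'"
        then have "x \<in> S I" by (simp add: True)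
        then obtain y z where yz: "x = y + z" "y \<in> J" "z \<in> I \<inter> J'"
          unfolding S_def by blast
        then have "y = x - z" by simp
        then have "y \<in> I'" using x yz(3) sub(1) subspace_diff[OF ss(2)] by auto
        then show "x \<in> {x + y |x y. x \<in> I' \<inter> J \<and> y \<in> I \<inter> J'}" using yz by blast
      qed
    qed (use sub in \<open>auto intro!: subspace_add[OF ss(2)] subspace_add[OF ss(4)]\<close>)
    moreover have "(I' \<inter> J) \<inter> (I \<inter> J') = I \<inter> J" using sub by blast
    ultimately show ?thesis
      using dim_sums_Int[of "I' \<inter> J" "I \<inter> J'"] ss by (simp add: subspace_inter)
  next
    case False
    then have I: "I \<inter> J' \<subseteq> J" using S[OF id(1)] Int_sub by blast
    have "S I' \<noteq> J'"
    proof
      assume S': "S I' = J'"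
      \<comment> \<open>Modulo \<open>J\<close>, \<open>x\<close> can be replaced by some
        \<open>v\<close> in \<open>I' \<inter> J'\<close>. Its products lie in \<open>I\<close> by
        centrality and in the ideal \<open>J'\<close>, hence in
        \<open>I \<inter> J' \<subseteq> J\<close>. So \<open>J'\<close> would be central over
        \<open>J\<close>.\<close>
      have "mult x y \<in> J \<and> mult y x \<in> J" if "x \<in> J'" for x y
      proof -
        obtain u v where uv: "x = u + v" "u \<in> J" "v \<in> I'" "v \<in> J'"
          using \<open>x \<in> J'\<close> S' unfolding S_def by blast
        have "mult u y \<in> J" "mult y u \<in> J" "mult v y \<in> J'" "mult y v \<in> J'"
          using id uv by (auto simp: ideal_def)
        moreover have "mult v y \<in> I" "mult y v \<in> I"
          using central uv(3) by (auto simp: central_factor_iff[OF id(1)])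
        ultimately show ?thesis
          using I by (auto simp: uv(1) mult_add_left mult_add_right intro!: subspace_add[OF ss(3)])
      qed
      then show False using chief(1) by (simp add: central_factor_iff[OF id(3)])
    qed
    then have "I' \<inter> J' \<subseteq> J" using S[OF id(2)] Int_sub by blast
    then have "I' \<inter> J' = I' \<inter> J" "I \<inter> J' = I \<inter> J" using I sub by auto
    then show ?thesis by simp
  qed
qed

section \<open>Double counting over two series\<close>

text \<open>The purely algebraic content of an adapted series. As no order occurs in it, series
  adapted to different orders become comparable.\<close>

definition central_chief_series :: "nat \<Rightarrow> (nat \<Rightarrow> 'a set) \<Rightarrow> bool" where
  "central_chief_series s I \<longleftrightarrow> I 0 = {0} \<and> I s = UNIV
     \<and> (\<forall>j<s. I j \<subseteq> I (Suc j)) \<and> (\<forall>j\<le>s. ideal (I j))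
     \<and> (\<forall>j<s. central_factor (I j) (I (Suc j)) \<or> chief_factor (I j) (I (Suc j)))"

lemma adapted_series_central_chief:
  "adapted_series r s I \<Longrightarrow> central_chief_series s I"
  unfolding adapted_series_def convex_series_def convex_ideal_def central_chief_series_def
  by blast

text \<open>This is \<open>d(j, k)\<close> by the dimension formula, the two summands of the
  denominator meeting in \<open>I j \<inter> J k\<close>. It is grouped as a difference in
  \<open>k\<close> for telescoping, with integer values because of the subtractions.\<close>

definition refinement_dim :: "(nat \<Rightarrow> 'a set) \<Rightarrow> (nat \<Rightarrow> 'a set) \<Rightarrow> nat \<Rightarrow> nat \<Rightarrow> int" where
  "refinement_dim I J j k =
     (int (dim (I (Suc j) \<inter> J (Suc k))) - int (dim (I j \<inter> J (Suc k))))
     - (int (dim (I (Suc j) \<inter> J k)) - int (dim (I j \<inter> J k)))"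

lemma refinement_dim_commute: "refinement_dim I J j k = refinement_dim J I k j"
  by (simp add: refinement_dim_def Int_commute)

lemma sum_refinement_dim:
  assumes "central_chief_series s I" "central_chief_series t J" "j < s"
  shows "(\<Sum>k<t. refinement_dim I J j k) = int (factor_dim (I j) (I (Suc j)))"
proof -
  have I: "ideal (I j)" "ideal (I (Suc j))" "I j \<subseteq> I (Suc j)"
    using assms(1,3) by (auto simp: central_chief_series_def)
  then have ss: "subspace (I j)" "subspace (I (Suc j))" by (auto simp: ideal_def)
  have J: "J 0 = {0}" "J t = UNIV"
    using assms(2) by (auto simp: central_chief_series_def)
  \<comment> \<open>Boundary terms of the telescoping sum: those at \<open>k = 0\<close> are zero,
    and at \<open>k = t\<close>, where \<open>J t\<close> is everything, the dimensions of
    \<open>I (Suc j)\<close> and \<open>I j\<close> remain.\<close>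
  have "I j \<inter> {0} = {0}" "I (Suc j) \<inter> {0} = {0}"
    using ss subspace_0 by auto
  then show ?thesis
    unfolding refinement_dim_def sum_lessThan_telescope[of
        "\<lambda>k. int (dim (I (Suc j) \<inter> J k)) - int (dim (I j \<inter> J k))" t]
    using factor_dim_add[OF ss I(3)] by (simp add: J)
qed

lemma refinement_dim_eq_0:
  assumes "central_chief_series s I" "central_chief_series t J" "j < s" "k < t"
    and "central_factor (I j) (I (Suc j))" "\<not> central_factor (J k) (J (Suc k))"
  shows "refinement_dim I J j k = 0"
proof -
  have "dim (I (Suc j) \<inter> J (Suc k)) + dim (I j \<inter> J k)
      = dim (I j \<inter> J (Suc k)) + dim (I (Suc j) \<inter> J k)"
    using assms by (intro dim_Int_central_chief) (auto simp: central_chief_series_def)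
  then show ?thesis by (simp add: refinement_dim_def)
qed

lemma series_rank_eq_sum_refinement_dim:
  assumes "central_chief_series s I" "central_chief_series t J"
  shows "int (series_rank s I) =
    (\<Sum>j | j < s \<and> central_factor (I j) (I (Suc j)).
       \<Sum>k | k < t \<and> central_factor (J k) (J (Suc k)). refinement_dim I J j k)"
  unfolding series_rank_def of_nat_sum
proof (rule sum.cong[OF refl])
  fix j assume "j \<in> {j. j < s \<and> central_factor (I j) (I (Suc j))}"
  then have j: "j < s" "central_factor (I j) (I (Suc j))" by auto
  \<comment> \<open>The added indices \<open>k\<close> have noncentral, hence chief, factors and
    contribute 0 against the central factor at \<open>j\<close>.\<close>
  have "(\<Sum>k | k < t \<and> central_factor (J k) (J (Suc k)). refinement_dim I J j k)
      = (\<Sum>k<t. refinement_dim I J j k)"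
    using refinement_dim_eq_0[OF assms j(1) _ j(2)] by (intro sum.mono_neutral_left) auto
  then show "int (factor_dim (I j) (I (Suc j)))
      = (\<Sum>k | k < t \<and> central_factor (J k) (J (Suc k)). refinement_dim I J j k)"
    using sum_refinement_dim[OF assms j(1)] by simp
qed

text \<open>Both ranks are the same double sum over pairs of central factors, taken in the two
  orders of summation.\<close>

lemma series_rank_unique:
  assumes "central_chief_series s I" "central_chief_series t J"
  shows "series_rank s I = series_rank t J"
proof -
  have "int (series_rank s I) = int (series_rank t J)"
    unfolding series_rank_eq_sum_refinement_dim[OF assms]
      series_rank_eq_sum_refinement_dim[OF assms(2,1)]
    by (subst sum.swap) (simp add: refinement_dim_commute[of I])
  then show ?thesis by simp
qed

end

theorem corollary3p23:
  fixes scale :: "'f::linordered_field \<Rightarrow> 'a::ab_group_add \<Rightarrow> 'a"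
    and mult :: "'a \<Rightarrow> 'a \<Rightarrow> 'a"
  assumes "nonassoc_algebra scale mult"
    and "nonassoc_algebra.finite_dimensional scale"
  shows "(\<forall>r. nonassoc_algebra.maximal_order scale mult r \<longrightarrow>
            (\<forall>s I t J. nonassoc_algebra.adapted_series scale mult r s I
                \<and> nonassoc_algebra.adapted_series scale mult r t J \<longrightarrow>
              nonassoc_algebra.series_rank scale mult s I
                = nonassoc_algebra.series_rank scale mult t J))
       \<and> (\<forall>r r' n n'. nonassoc_algebra.maximal_order scale mult r
              \<and> nonassoc_algebra.maximal_order scale mult r'
              \<and> nonassoc_algebra.has_rank scale mult r n
              \<and> nonassoc_algebra.has_rank scale mult r' n' \<longrightarrow> n = n')"
proof -
  interpret nonassoc_algebra scale mult by (fact assms(1))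
  obtain B where B: "finite B" "span B = UNIV"
    using assms(2) by (auto simp: finite_dimensional_def)
  obtain C where C: "C \<subseteq> B" "independent C" "B \<subseteq> span C"
    using maximal_independent_subset by blast
  \<comment> \<open>A maximal independent subset of the finite spanning set \<open>B\<close> is the
    finite basis that the finite-dimensional locale requires.\<close>
  have "span C = UNIV" using span_mono[OF C(3)] B(2) by (auto simp: span_span)
  then interpret fin_dim_nonassoc_algebra scale mult C
    using C(1,2) B(1) by unfold_locales (auto intro: finite_subset)
  \<comment> \<open>Both claims follow at once, because the comparison of two series no longer
    refers to the orders they are adapted to.\<close>
  show ?thesis
    unfolding has_rank_def
    using series_rank_unique[OF adapted_series_central_chief adapted_series_central_chief]
    by blast
qed

end
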